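(* Let $(V,h)$ be an $n$-dimensional Euclidean vector space. For $X,Y\in\mathcal{MC}(V^* )$, $$\operatorname{tr}(\widehat X_{\Lambda^2V^*}\circ\widehat Y_{\Lambda^2V^*})=\tfrac14\langle X,Y\rangle,\qquad\operatorname{tr}(\widehat X_{S^2V^*}\circ\widehat Y_{S^2V^*})=\tfrac34\langle X,Y\rangle.$$ The $O(n)$-equivariant linear maps $\mathcal{MC}(V^* )\to\operatorname{Sym}(\Lambda^2V^* )$, $\mathcal{MC}(V^* )\to\operatorname{Sym}(S^2V^* )$, and $\mathcal{MC}(V^* )\to\operatorname{Sym}(\otimes^2V^* )$ given by $X\mapsto2\widehat X_{\Lambda^2V^*}$, $X\mapsto\tfrac{2}{\sqrt3}\widehat X_{S^2V^*}$, and $X\mapsto\widehat X_{\otimes^2V^*}$ are isometric with respect to the trace-norms on the targets and injective.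
   Context: $V$ is a real vector space with positive definite symmetric bilinear form $h_{ij}$; indices are raised and lowered with $h$; brackets around indices denote complete antisymmetrization, normalized to be a projection. $\mathcal{MC}(V^* )=\{Y_{ijkl}\in\otimes^4V^*: Y_{[ij]kl}=Y_{ijkl}=Y_{ij[kl]},\ Y_{[ijk]l}=0\}$, with $\langle X,Y\rangle=X_{ijkl}Y^{ijkl}$. For $X\in\mathcal{MC}(V^* )$, $\widehat X_{\otimes^2V^*}\in\operatorname{End}(\otimes^2V^* )$ is $\widehat X(\alpha)_{ij}=X^{p}{}_{ij}{}^{q}\alpha_{pq}$; it preserves $\Lambda^2V^*$ and $S^2V^*$, with restrictions $\widehat X_{\Lambda^2V^*}$, $\widehat X_{S^2V^*}$. $\operatorname{Sym}(W)$ denotes the endomorphisms of $W$ self-adjoint for the inner product on $W$ given by complete contraction with $h$; the trace-norm on it is that of the inner product $(A,B)\mapsto\operatorname{tr}(A\circ B)$. $O(n)=O(h)$ acts on all spaces by its induced actions. *)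

theory Defs
  imports "HOL-Analysis.Analysis"
begin

text \<open>
  The Euclidean vector space \<open>(V, h)\<close> is a type \<open>'a::euclidean_space\<close> with \<open>h = (\<bullet>)\<close> and
  \<open>n = DIM('a)\<close>.  Covariant tensors are multilinear forms on \<open>'a\<close>, represented by iterated
  bounded linear functions (boundedness is automatic in finite dimension), and
  \<open>X i j k l\<close> is the value of \<open>X\<close> on the vectors \<open>i, j, k, l\<close>.  As \<open>Basis\<close> is orthonormal,
  contraction with \<open>h\<close> is summation over \<open>Basis\<close>, regardless of the position of the indices.
\<close>

type_synonym 'a tensor2 = "'a \<Rightarrow>\<^sub>L 'a \<Rightarrow>\<^sub>L real"
type_synonym 'a tensor4 = "'a \<Rightarrow>\<^sub>L 'a \<Rightarrow>\<^sub>L 'a \<Rightarrow>\<^sub>L 'a \<Rightarrow>\<^sub>L real"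

definition MC :: "('a::euclidean_space) tensor4 set" where
  "MC = {Y :: 'a tensor4. (\<forall>i j k l. (Y i j k l - Y j i k l) / 2 = Y i j k l) \<and>
            (\<forall>i j k l. (Y i j k l - Y i j l k) / 2 = Y i j k l) \<and>
            (\<forall>i j k l. (Y i j k l + Y j k i l + Y k i j l
                        - Y j i k l - Y i k j l - Y k j i l) / 6 = 0)}"

definition Lambda2 :: "('a::euclidean_space) tensor2 set" where
  "Lambda2 = {\<alpha> :: 'a tensor2. \<forall>i j. \<alpha> j i = - \<alpha> i j}"

definition Sym2 :: "('a::euclidean_space) tensor2 set" where
  "Sym2 = {\<alpha> :: 'a tensor2. \<forall>i j. \<alpha> j i = \<alpha> i j}"

definition inner2 :: "('a::euclidean_space) tensor2 \<Rightarrow> 'a tensor2 \<Rightarrow> real" where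
  "inner2 \<alpha> \<beta> = (\<Sum>i\<in>Basis. \<Sum>j\<in>Basis. \<alpha> i j * \<beta> i j)"

definition inner4 :: "('a::euclidean_space) tensor4 \<Rightarrow> 'a tensor4 \<Rightarrow> real" where
  "inner4 X Y = (\<Sum>i\<in>Basis. \<Sum>j\<in>Basis. \<Sum>k\<in>Basis. \<Sum>l\<in>Basis. X i j k l * Y i j k l)"

text \<open>
  The tensor with given components; meaningful only when \<open>f\<close> is multilinear
  (see \<open>tensor2_of_apply\<close> and \<open>tensor4_of_apply\<close>).
\<close>

definition tensor2_of :: "('a::euclidean_space \<Rightarrow> 'a \<Rightarrow> real) \<Rightarrow> 'a tensor2" where
  "tensor2_of f = Blinfun (\<lambda>i. Blinfun (\<lambda>j. f i j))"

definition tensor4_of :: "('a::euclidean_space \<Rightarrow> 'a \<Rightarrow> 'a \<Rightarrow> 'a \<Rightarrow> real) \<Rightarrow> 'a tensor4" where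
  "tensor4_of f = Blinfun (\<lambda>i. Blinfun (\<lambda>j. Blinfun (\<lambda>k. Blinfun (\<lambda>l. f i j k l))))"

lemma Blinfun_apply_linear:
  fixes f :: "'a::euclidean_space \<Rightarrow> 'b::real_normed_vector"
  assumes "linear f"
  shows "blinfun_apply (Blinfun f) = f"
  using assms by (simp add: bounded_linear_Blinfun_apply linear_conv_bounded_linear)

lemma linear_Blinfun:
  fixes f :: "'a::real_vector \<Rightarrow> 'b::euclidean_space \<Rightarrow> 'c::real_normed_vector"
  assumes "\<And>i. linear (f i)" "\<And>j. linear (\<lambda>i. f i j)"
  shows "linear (\<lambda>i. Blinfun (f i))"
  by (rule linearI; rule blinfun_eqI)
     (simp_all add: Blinfun_apply_linear assms(1) blinfun.add_left blinfun.scaleR_left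
        linear_add[OF assms(2)] linear_cmul[OF assms(2)])

lemma tensor2_of_apply:
  assumes "\<And>j. linear (\<lambda>i. f i j)" "\<And>i. linear (\<lambda>j. f i j)"
  shows "tensor2_of f i j = f i j"
  unfolding tensor2_of_def
  by (simp add: Blinfun_apply_linear linear_Blinfun assms)

lemma tensor4_of_apply:
  assumes "\<And>j k l. linear (\<lambda>i. f i j k l)" "\<And>i k l. linear (\<lambda>j. f i j k l)"
    "\<And>i j l. linear (\<lambda>k. f i j k l)" "\<And>i j k. linear (\<lambda>l. f i j k l)"
  shows "tensor4_of f i j k l = f i j k l"
proof -
  have 1: "linear (\<lambda>k. Blinfun (f i j k))" for i j
    by (rule linear_Blinfun; rule assms)
  have 2: "linear (\<lambda>j. Blinfun (\<lambda>k. Blinfun (f i j k)))" for i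
    by (rule linear_Blinfun[OF 1], rule linear_Blinfun; rule assms)
  have 3: "linear (\<lambda>i. Blinfun (\<lambda>j. Blinfun (\<lambda>k. Blinfun (f i j k))))"
    by (rule linear_Blinfun[OF 2], rule linear_Blinfun[OF 1], rule linear_Blinfun; rule assms)
  show ?thesis
    unfolding tensor4_of_def by (simp add: Blinfun_apply_linear 1 2 3 assms)
qed

definition hat :: "('a::euclidean_space) tensor4 \<Rightarrow> 'a tensor2 \<Rightarrow> 'a tensor2" where
  "hat X \<alpha> = tensor2_of (\<lambda>i j. \<Sum>p\<in>Basis. \<Sum>q\<in>Basis. X p i j q * \<alpha> p q)"

lemma hat_apply: "hat X \<alpha> i j = (\<Sum>p\<in>Basis. \<Sum>q\<in>Basis. X p i j q * \<alpha> p q)"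
  unfolding hat_def
  by (rule tensor2_of_apply; rule linearI)
     (simp_all add: blinfun.bilinear_simps algebra_simps sum.distrib sum_distrib_left)

text \<open>
  An endomorphism of a subspace \<open>W\<close> of the second tensor power of the dual of \<open>V\<close> is
  represented by a function on all tensors that vanishes outside \<open>W\<close>, so that equality, sums and
  scalar multiples of endomorphisms of \<open>W\<close> are those of functions, and composition is \<open>\<circ>\<close>.
\<close>

definition End_on :: "('a::euclidean_space) tensor2 set \<Rightarrow> ('a tensor2 \<Rightarrow> 'a tensor2) set" where
  "End_on W = {A. (\<forall>\<alpha>\<in>W. A \<alpha> \<in> W) \<and>
      (\<forall>\<alpha>\<in>W. \<forall>\<beta>\<in>W. A (\<alpha> + \<beta>) = A \<alpha> + A \<beta>) \<and>
      (\<forall>c. \<forall>\<alpha>\<in>W. A (c *\<^sub>R \<alpha>) = c *\<^sub>R A \<alpha>) \<and>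
      (\<forall>\<alpha>. \<alpha> \<notin> W \<longrightarrow> A \<alpha> = 0)}"

definition Sym_on :: "('a::euclidean_space) tensor2 set \<Rightarrow> ('a tensor2 \<Rightarrow> 'a tensor2) set" where
  "Sym_on W = {A \<in> End_on W. \<forall>\<alpha>\<in>W. \<forall>\<beta>\<in>W. inner2 (A \<alpha>) \<beta> = inner2 \<alpha> (A \<beta>)}"

definition hat_on ::
  "('a::euclidean_space) tensor2 set \<Rightarrow> 'a tensor4 \<Rightarrow> 'a tensor2 \<Rightarrow> 'a tensor2" where
  "hat_on W X = (\<lambda>\<alpha>. if \<alpha> \<in> W then hat X \<alpha> else 0)"

text \<open>The value does not depend on the choice of the basis: see \<open>trace_on_eq\<close>.\<close>

definition trace_on ::
  "('b::real_vector) set \<Rightarrow> ('b \<Rightarrow> 'b) \<Rightarrow> real" where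
  "trace_on W A =
     (let B = (SOME B. independent B \<and> span B = W) in \<Sum>b\<in>B. representation B (A b) b)"

lemma trace_basis_independent:
  fixes B C :: "('b::real_vector) set"
  assumes B: "finite B" "independent B" "span B = W"
    and C: "finite C" "independent C" "span C = W"
    and maps: "\<And>x. x \<in> W \<Longrightarrow> A x \<in> W"
    and add: "\<And>x y. x \<in> W \<Longrightarrow> y \<in> W \<Longrightarrow> A (x + y) = A x + A y"
    and scale: "\<And>c x. x \<in> W \<Longrightarrow> A (c *\<^sub>R x) = c *\<^sub>R A x"
  shows "(\<Sum>b\<in>B. representation B (A b) b) = (\<Sum>c\<in>C. representation C (A c) c)"
proof -
  have W: "subspace W" using B(3) by (metis subspace_span)
  have A0: "A 0 = 0" using scale[of 0 0] subspace_0[OF W] by simp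
  have A_sum: "A (\<Sum>s\<in>S. f s *\<^sub>R s) = (\<Sum>s\<in>S. f s *\<^sub>R A s)"
    if "finite S" "S \<subseteq> W" for S and f :: "'b \<Rightarrow> real"
    using that
  proof (induction S rule: finite_induct)
    case empty
    show ?case using A0 by simp
  next
    case (insert s S)
    moreover have "(\<Sum>s\<in>S. f s *\<^sub>R s) \<in> W"
      using insert.prems W by (intro subspace_sum) (auto intro: subspace_scale)
    ultimately show ?case
      using W by (simp add: add scale subspace_scale)
  qed
  have rep_sum: "representation D (\<Sum>s\<in>S. f s *\<^sub>R g s) d = (\<Sum>s\<in>S. f s * representation D (g s) d)"
    if "independent D" "span D = W" "\<And>s. s \<in> S \<Longrightarrow> g s \<in> W"
    for D :: "'b set" and S :: "'b set" and f :: "'b \<Rightarrow> real" and g d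
    using that by (subst representation_sum) (auto intro!: sum.cong simp: representation_scale span_scale)
  have BW: "B \<subseteq> W" and CW: "C \<subseteq> W" using B C span_superset by auto
  have expand: "x = (\<Sum>d\<in>D. representation D x d *\<^sub>R d)"
    if "finite D" "independent D" "span D = W" "x \<in> W" for x and D :: "'b set"
    using sum_representation_eq[of D x D] that by simp
  have l: "representation B (A b) b
      = (\<Sum>c\<in>C. representation C b c * representation B (A c) b)" if "b \<in> B" for b
  proof -
    have "A b = A (\<Sum>c\<in>C. representation C b c *\<^sub>R c)"
      using expand[OF C] that BW by auto
    also have "\<dots> = (\<Sum>c\<in>C. representation C b c *\<^sub>R A c)"
      by (rule A_sum[OF C(1) CW])
    finally show ?thesis using rep_sum[OF B(2,3)] CW maps by (simp add: subset_iff)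
  qed
  have r: "representation C (A c) c
      = (\<Sum>b\<in>B. representation B (A c) b * representation C b c)" if "c \<in> C" for c
  proof -
    have "A c = (\<Sum>b\<in>B. representation B (A c) b *\<^sub>R b)"
      using expand[OF B] that CW maps by auto
    then have "representation C (A c) c
        = representation C (\<Sum>b\<in>B. representation B (A c) b *\<^sub>R b) c" by simp
    also have "\<dots> = (\<Sum>b\<in>B. representation B (A c) b * representation C b c)"
      using rep_sum[OF C(2,3)] BW by (simp add: subset_iff)
    finally show ?thesis .
  qed
  have "(\<Sum>b\<in>B. representation B (A b) b)
      = (\<Sum>b\<in>B. \<Sum>c\<in>C. representation C b c * representation B (A c) b)"
    using l by simp
  also have "\<dots> = (\<Sum>c\<in>C. \<Sum>b\<in>B. representation B (A c) b * representation C b c)"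
    by (subst sum.swap) (simp add: mult.commute)
  also have "\<dots> = (\<Sum>c\<in>C. representation C (A c) c)"
    using r by simp
  finally show ?thesis .
qed

lemma trace_on_eq:
  fixes B :: "('b::real_vector) set"
  assumes B: "finite B" "independent B" "span B = W"
    and A: "\<And>x. x \<in> W \<Longrightarrow> A x \<in> W"
      "\<And>x y. x \<in> W \<Longrightarrow> y \<in> W \<Longrightarrow> A (x + y) = A x + A y"
      "\<And>c x. x \<in> W \<Longrightarrow> A (c *\<^sub>R x) = c *\<^sub>R A x"
  shows "trace_on W A = (\<Sum>b\<in>B. representation B (A b) b)"
proof -
  define C where "C = (SOME C. independent C \<and> span C = W)"
  have C: "independent C \<and> span C = W"
    unfolding C_def by (rule someI[where x = B]) (simp add: B)
  have "finite C"
    using independent_span_bound[OF B(1), of C] C B(3) span_superset by auto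
  then show ?thesis
    using trace_basis_independent[OF B, of C A] C A
    by (simp add: trace_on_def C_def[symmetric] Let_def)
qed

definition trace_norm :: "('a::euclidean_space) tensor2 set \<Rightarrow> ('a tensor2 \<Rightarrow> 'a tensor2) \<Rightarrow> real"
  where "trace_norm W A = sqrt (trace_on W (A \<circ> A))"

definition norm4 :: "('a::euclidean_space) tensor4 \<Rightarrow> real" where
  "norm4 X = sqrt (inner4 X X)"

text \<open>
  The actions induced by \<open>g \<in> O(n)\<close>, that is \<open>orthogonal_transformation g\<close>.  As \<open>W\<close> below is
  always invariant, \<open>act_End g\<close> preserves the convention of vanishing outside \<open>W\<close>.
\<close>

definition act2 :: "('a::euclidean_space \<Rightarrow> 'a) \<Rightarrow> 'a tensor2 \<Rightarrow> 'a tensor2" where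
  "act2 g \<alpha> = tensor2_of (\<lambda>i j. \<alpha> (inv g i) (inv g j))"

definition act4 :: "('a::euclidean_space \<Rightarrow> 'a) \<Rightarrow> 'a tensor4 \<Rightarrow> 'a tensor4" where
  "act4 g X = tensor4_of (\<lambda>i j k l. X (inv g i) (inv g j) (inv g k) (inv g l))"

definition act_End ::
  "('a::euclidean_space \<Rightarrow> 'a) \<Rightarrow> ('a tensor2 \<Rightarrow> 'a tensor2) \<Rightarrow> 'a tensor2 \<Rightarrow> 'a tensor2" where
  "act_End g A = act2 g \<circ> A \<circ> act2 (inv g)"

lemma linear_inv_orthogonal:
  fixes g :: "'a::euclidean_space \<Rightarrow> 'a"
  assumes "orthogonal_transformation g"
  shows "linear (inv g)"
  using assms orthogonal_transformation_inv orthogonal_transformation_linear by blast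

lemma act2_apply:
  assumes "orthogonal_transformation g"
  shows "act2 g \<alpha> i j = \<alpha> (inv g i) (inv g j)"
  unfolding act2_def using linear_inv_orthogonal[OF assms]
  by (intro tensor2_of_apply; intro linearI)
     (simp_all add: linear_add linear_cmul blinfun.bilinear_simps)

lemma act4_apply:
  assumes "orthogonal_transformation g"
  shows "act4 g X i j k l = X (inv g i) (inv g j) (inv g k) (inv g l)"
  unfolding act4_def using linear_inv_orthogonal[OF assms]
  by (intro tensor4_of_apply; intro linearI)
     (simp_all add: linear_add linear_cmul blinfun.bilinear_simps)

text \<open>Properties of a map from \<open>MC\<close> to \<open>Sym_on W\<close>; its values outside \<open>MC\<close> are irrelevant.\<close>

definition linear_to_Sym_on ::
  "('a::euclidean_space) tensor2 set \<Rightarrow> ('a tensor4 \<Rightarrow> 'a tensor2 \<Rightarrow> 'a tensor2) \<Rightarrow> bool" where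
  "linear_to_Sym_on W \<Phi> \<longleftrightarrow>
     (\<forall>X\<in>MC. \<Phi> X \<in> Sym_on W) \<and>
     (\<forall>X\<in>MC. \<forall>Y\<in>MC. \<Phi> (X + Y) = (\<lambda>\<alpha>. \<Phi> X \<alpha> + \<Phi> Y \<alpha>)) \<and>
     (\<forall>c. \<forall>X\<in>MC. \<Phi> (c *\<^sub>R X) = (\<lambda>\<alpha>. c *\<^sub>R \<Phi> X \<alpha>))"

definition O_equivariant ::
  "(('a::euclidean_space) tensor4 \<Rightarrow> 'a tensor2 \<Rightarrow> 'a tensor2) \<Rightarrow> bool" where
  "O_equivariant \<Phi> \<longleftrightarrow>
     (\<forall>g. orthogonal_transformation g \<longrightarrow>
        (\<forall>X\<in>MC. act4 g X \<in> MC \<and> \<Phi> (act4 g X) = act_End g (\<Phi> X)))"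

definition trace_isometric ::
  "('a::euclidean_space) tensor2 set \<Rightarrow> ('a tensor4 \<Rightarrow> 'a tensor2 \<Rightarrow> 'a tensor2) \<Rightarrow> bool" where
  "trace_isometric W \<Phi> \<longleftrightarrow> (\<forall>X\<in>MC. trace_norm W (\<Phi> X) = norm4 X)"

definition isometric_O_embedding ::
  "('a::euclidean_space) tensor2 set \<Rightarrow> ('a tensor4 \<Rightarrow> 'a tensor2 \<Rightarrow> 'a tensor2) \<Rightarrow> bool" where
  "isometric_O_embedding W \<Phi> \<longleftrightarrow>
     linear_to_Sym_on W \<Phi> \<and> O_equivariant \<Phi> \<and> trace_isometric W \<Phi> \<and> inj_on \<Phi> MC"

lemma subspace_MC: "subspace (MC :: ('a::euclidean_space) tensor4 set)"
proof -
  have MC_iff: "Y \<in> MC \<longleftrightarrow> (\<forall>i j k l. Y j i k l = - Y i j k l) \<and> (\<forall>i j k l. Y i j l k = - Y i j k l) \<and>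
      (\<forall>i j k l. Y i j k l + Y j k i l + Y k i j l - Y j i k l - Y i k j l - Y k j i l = 0)"
    for Y :: "'a tensor4"
  proof -
    have "(a - b) / 2 = a \<longleftrightarrow> b = - a" for a b :: real
      by (auto simp: field_simps)
    then show ?thesis unfolding MC_def by simp
  qed
  have D: "Y j i k l = - Y i j k l" "Y i j l k = - Y i j k l"
    "Y i j k l + Y j k i l + Y k i j l - Y j i k l - Y i k j l - Y k j i l = 0"
    if "Y \<in> MC" for Y :: "'a tensor4" and i j k l
    using that[unfolded MC_iff] by (blast, blast, blast)
  have "X + Y \<in> MC" if "X \<in> MC" "Y \<in> MC" for X Y :: "'a tensor4"
    unfolding MC_iff blinfun.add_left
  proof (intro conjI allI)
    fix i j k l
    show "X j i k l + Y j i k l = - (X i j k l + Y i j k l)"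
      using D(1)[OF that(1), of j i k l] D(1)[OF that(2), of j i k l] by linarith
    show "X i j l k + Y i j l k = - (X i j k l + Y i j k l)"
      using D(2)[OF that(1), of i j l k] D(2)[OF that(2), of i j l k] by linarith
    show "X i j k l + Y i j k l + (X j k i l + Y j k i l) + (X k i j l + Y k i j l)
        - (X j i k l + Y j i k l) - (X i k j l + Y i k j l) - (X k j i l + Y k j i l) = 0"
      using D(3)[OF that(1), of i j k l] D(3)[OF that(2), of i j k l] by linarith
  qed
  moreover have "c *\<^sub>R X \<in> MC" if "X \<in> MC" for c and X :: "'a tensor4"
    unfolding MC_iff blinfun.scaleR_left real_scaleR_def
  proof (intro conjI allI)
    fix i j k l
    show "c * X j i k l = - (c * X i j k l)"
      by (subst D(1)[OF that]) simp
    show "c * X i j l k = - (c * X i j k l)"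
      by (subst D(2)[OF that]) simp
    show "c * X i j k l + c * X j k i l + c * X k i j l
        - c * X j i k l - c * X i k j l - c * X k j i l = 0"
      using D(3)[OF that, of i j k l]
      by (simp only: distrib_left[symmetric] right_diff_distrib[symmetric] mult_zero_right)
  qed
  moreover have "0 \<in> (MC :: 'a tensor4 set)" by (simp add: MC_def)
  ultimately show ?thesis by (simp add: subspace_def)
qed

end

theory Submission
  imports Defs
begin

text \<open>
  The spaces \<open>Lambda2\<close>, \<open>Sym2\<close> and \<open>UNIV\<close> are the images of the projections \<open>\<alpha> \<mapsto> c \<alpha> + d \<alpha>\<^sup>t\<close> with
  \<open>(c, d) = (1/2, -1/2), (1/2, 1/2), (1, 0)\<close>.  On such an image the trace of
  \<open>hat X \<circ> hat Y\<close> equals \<open>c S + d T\<close> where \<open>S = X\<^sub>i\<^sub>j\<^sub>k\<^sub>l Y\<^sub>i\<^sub>j\<^sub>k\<^sub>l\<close> and \<open>T = X\<^sub>i\<^sub>j\<^sub>k\<^sub>l Y\<^sub>i\<^sub>k\<^sub>j\<^sub>l\<close>.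
  Contracting the Bianchi identity for \<open>Y\<close> with \<open>X\<close> gives \<open>S = 2 T\<close>, so the trace is
  \<open>(c + d/2) \<langle>X, Y\<rangle>\<close>.  Injectivity follows from isometry because \<open>\<langle>X, X\<rangle>\<close> is definite.
\<close>

section \<open>Symmetries of the tensors in \<open>MC\<close>\<close>

lemma MC_antisym12: "Y j i k l = - Y i j k l" if "Y \<in> MC"
  for Y :: "('a::euclidean_space) tensor4"
proof -
  have "(Y i j k l - Y j i k l) / 2 = Y i j k l" using that unfolding MC_def by blast
  then show ?thesis by (simp add: field_simps)
qed

lemma MC_antisym34: "Y i j l k = - Y i j k l" if "Y \<in> MC"
  for Y :: "('a::euclidean_space) tensor4"
proof -
  have "(Y i j k l - Y i j l k) / 2 = Y i j k l" using that unfolding MC_def by blast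
  then show ?thesis by (simp add: field_simps)
qed

text \<open>Antisymmetry in the first pair turns each odd permutation in the antisymmetrization into
  minus an even one, so the six terms reduce to twice the cyclic sum.\<close>

lemma MC_bianchi: "Y i j k l + Y j k i l + Y k i j l = 0" if "Y \<in> MC"
  for Y :: "('a::euclidean_space) tensor4"
proof -
  have "(Y i j k l + Y j k i l + Y k i j l - Y j i k l - Y i k j l - Y k j i l) / 6 = 0"
    using that unfolding MC_def by blast
  then show ?thesis
    using MC_antisym12[OF that, of i j k l] MC_antisym12[OF that, of k i j l]
      MC_antisym12[OF that, of j k i l] by simp
qed

text \<open>Take the four Bianchi identities in which each index in turn stands last. The first plus
  the second minus the other two leaves, by antisymmetry, twice the difference of the two
  sides.\<close>

lemma MC_pair_symmetric: "Y i j k l = Y k l i j" if "Y \<in> MC"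
  for Y :: "('a::euclidean_space) tensor4"
  using MC_bianchi[OF that, of i j k l] MC_bianchi[OF that, of j k l i]
    MC_bianchi[OF that, of k l i j] MC_bianchi[OF that, of l i j k]
    MC_antisym12[OF that] MC_antisym34[OF that]
  by (smt (verit))

lemma MC_flip: "Y i j k l = Y j i l k" if "Y \<in> MC"
  for Y :: "('a::euclidean_space) tensor4"
  using MC_antisym12[OF that, of i j l k] MC_antisym34[OF that, of i j l k] by simp

lemma MC_I:
  fixes Y :: "('a::euclidean_space) tensor4"
  assumes "\<And>i j k l. Y j i k l = - Y i j k l" "\<And>i j k l. Y i j l k = - Y i j k l"
    "\<And>i j k l. Y i j k l + Y j k i l + Y k i j l = 0"
  shows "Y \<in> MC"
proof -
  have "(Y i j k l - Y j i k l) / 2 = Y i j k l" for i j k l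
    using assms(1)[of i j k l] by simp
  moreover have "(Y i j k l - Y i j l k) / 2 = Y i j k l" for i j k l
    using assms(2)[of i j k l] by simp
  moreover have "(Y i j k l + Y j k i l + Y k i j l - Y j i k l - Y i k j l - Y k j i l) / 6 = 0"
    for i j k l
    using assms(3)[of i j k l] assms(1)[of i j k l] assms(1)[of k i j l] assms(1)[of j k i l]
    by simp
  ultimately show ?thesis unfolding MC_def by blast
qed

section \<open>Contractions of two curvature tensors\<close>

text \<open>In the Bianchi identity for \<open>Y\<close>, contracted with \<open>X\<close>, both
  rotated terms equal \<open>- ?T\<close>: one after exchanging \<open>i\<close> and
  \<open>j\<close> and using antisymmetry of \<open>X\<close>, the other by antisymmetry of
  \<open>Y\<close>.\<close>

lemma inner4_transpose23:
  fixes X Y :: "('a::euclidean_space) tensor4"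
  assumes "X \<in> MC" "Y \<in> MC"
  shows "(\<Sum>i\<in>Basis. \<Sum>j\<in>Basis. \<Sum>k\<in>Basis. \<Sum>l\<in>Basis. X i j k l * Y i k j l) = inner4 X Y / 2"
    (is "?T = _")
proof -
  let ?S = "\<lambda>f. \<Sum>i\<in>Basis. \<Sum>j\<in>Basis. \<Sum>k\<in>Basis. \<Sum>l\<in>Basis. f i j k l :: real"
  have "?S (\<lambda>i j k l. X i j k l * Y j k i l) = ?S (\<lambda>i j k l. X j i k l * Y i k j l)"
    by (rule sum.swap)
  also have "\<dots> = ?S (\<lambda>i j k l. - (X i j k l * Y i k j l))"
    by (intro sum.cong refl, subst MC_antisym12[OF assms(1)]) simp
  finally have 1: "?S (\<lambda>i j k l. X i j k l * Y j k i l) = - ?T" by (simp add: sum_negf)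
  have "?S (\<lambda>i j k l. X i j k l * Y k i j l) = ?S (\<lambda>i j k l. - (X i j k l * Y i k j l))"
    by (intro sum.cong refl, subst MC_antisym12[OF assms(2)]) simp
  then have 2: "?S (\<lambda>i j k l. X i j k l * Y k i j l) = - ?T" by (simp add: sum_negf)
  have "0 = ?S (\<lambda>i j k l. X i j k l * (Y i j k l + Y j k i l + Y k i j l))"
    by (simp add: MC_bianchi[OF assms(2)])
  also have "\<dots> = inner4 X Y - ?T - ?T"
    unfolding inner4_def distrib_left sum.distrib 1 2 by simp
  finally show ?thesis by simp
qed

lemma inner4_eq_0D:
  fixes X :: "('a::euclidean_space) tensor4"
  assumes "inner4 X X = 0"
  shows "X = 0"
proof -
  have sq: "(\<Sum>l\<in>Basis. X i j k l * X i j k l) \<ge> 0"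
    "(\<Sum>k\<in>Basis. \<Sum>l\<in>Basis. X i j k l * X i j k l) \<ge> 0"
    "(\<Sum>j\<in>Basis. \<Sum>k\<in>Basis. \<Sum>l\<in>Basis. X i j k l * X i j k l) \<ge> 0" for i j k
    by (intro sum_nonneg; simp)+
  have "X i j k l = 0" if "i \<in> Basis" "j \<in> Basis" "k \<in> Basis" "l \<in> Basis" for i j k l
    using assms that unfolding inner4_def
    by (simp add: sum_nonneg_eq_0_iff sq)
  then show ?thesis
    by (intro blinfun_euclidean_eqI) simp
qed

section \<open>Traces computed from a spanning family\<close>

text \<open>
  The \<open>e t\<close> may be linearly dependent, as are the projections of the tensors
  \<open>a \<otimes> b\<close> with \<open>a, b \<in> Basis\<close>; this avoids choosing bases of \<open>Lambda2\<close> and \<open>Sym2\<close>.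
\<close>

lemma trace_on_frame:
  fixes e :: "'i \<Rightarrow> 'b::real_vector" and \<phi> :: "'i \<Rightarrow> 'b \<Rightarrow> real"
  assumes T: "finite T" and W: "subspace W" and e: "\<And>t. t \<in> T \<Longrightarrow> e t \<in> W"
    and \<phi>: "\<And>t. t \<in> T \<Longrightarrow> linear (\<phi> t)"
    and expand: "\<And>x. x \<in> W \<Longrightarrow> x = (\<Sum>t\<in>T. \<phi> t x *\<^sub>R e t)"
    and A: "\<And>x. x \<in> W \<Longrightarrow> A x \<in> W"
      "\<And>x y. x \<in> W \<Longrightarrow> y \<in> W \<Longrightarrow> A (x + y) = A x + A y"
      "\<And>c x. x \<in> W \<Longrightarrow> A (c *\<^sub>R x) = c *\<^sub>R A x"
  shows "trace_on W A = (\<Sum>t\<in>T. \<phi> t (A (e t)))"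
proof -
  \<comment> \<open>A genuine basis \<open>B\<close> gives access to \<open>trace_on_eq\<close>; it
    is eliminated again at the end. Its finiteness comes from \<open>W\<close> lying in the span of
    the finite family.\<close>
  obtain B where B: "B \<subseteq> W" "independent B" "span B = W"
    using basis_exists[of W] W by (metis span_minimal subset_antisym)
  have "W \<subseteq> span (e ` T)"
  proof
    fix x assume "x \<in> W"
    then have "x = (\<Sum>t\<in>T. \<phi> t x *\<^sub>R e t)" by (rule expand)
    then show "x \<in> span (e ` T)"
      by (metis (no_types, lifting) imageI span_base span_scale span_sum)
  qed
  then have fB: "finite B"
    using independent_span_bound[of "e ` T" B] B T by auto
  have A0: "A 0 = 0" using A(3)[of 0 0] subspace_0[OF W] by simp
  have A_sum: "A (\<Sum>t\<in>S. f t *\<^sub>R e t) = (\<Sum>t\<in>S. f t *\<^sub>R A (e t))"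
    if "finite S" "S \<subseteq> T" for S f
    using that
  proof (induction S rule: finite_induct)
    case (insert s S)
    moreover have "(\<Sum>t\<in>S. f t *\<^sub>R e t) \<in> W"
      using insert.prems W e by (intro subspace_sum) (auto intro: subspace_scale)
    ultimately show ?case
      using W e by (simp add: A subspace_scale)
  qed (simp add: A0)
  have "representation B (A b) b = (\<Sum>t\<in>T. \<phi> t b * representation B (A (e t)) b)"
    if "b \<in> B" for b
  proof -
    have "A b = (\<Sum>t\<in>T. \<phi> t b *\<^sub>R A (e t))"
      using A_sum[OF T order_refl, of "\<lambda>t. \<phi> t b"] expand[of b] that B(1) by auto
    moreover have "A (e t) \<in> span B" if "t \<in> T" for t
      using A(1) e that B(3) by simp
    ultimately show ?thesis
      using B(2) by (simp add: representation_sum representation_scale span_scale)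
  qed
  then have "trace_on W A = (\<Sum>b\<in>B. \<Sum>t\<in>T. \<phi> t b * representation B (A (e t)) b)"
    using trace_on_eq[where A = A, OF fB B(2,3) A] by simp
  also have "\<dots> = (\<Sum>t\<in>T. \<Sum>b\<in>B. \<phi> t b * representation B (A (e t)) b)"
    by (rule sum.swap)
  also have "\<dots> = (\<Sum>t\<in>T. \<phi> t (A (e t)))"
  proof (rule sum.cong[OF refl])
    fix t assume t: "t \<in> T"
    \<comment> \<open>Expanding \<open>A (e t)\<close> in \<open>B\<close> and applying the
      functional \<open>\<phi> t\<close> absorbs the sum over \<open>B\<close>.\<close>
    have "A (e t) = (\<Sum>b\<in>B. representation B (A (e t)) b *\<^sub>R b)"
      using sum_representation_eq[of B "A (e t)" B] A(1) e t B fB by simp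
    then have "\<phi> t (A (e t)) = \<phi> t (\<Sum>b\<in>B. representation B (A (e t)) b *\<^sub>R b)"
      by simp
    also have "\<dots> = (\<Sum>b\<in>B. \<phi> t b * representation B (A (e t)) b)"
      by (simp add: linear_sum[OF \<phi>[OF t]] linear_cmul[OF \<phi>[OF t]] mult.commute)
    finally show "(\<Sum>b\<in>B. \<phi> t b * representation B (A (e t)) b) = \<phi> t (A (e t))" ..
  qed
  finally show ?thesis .
qed

section \<open>Basis expansions and orthogonal change of basis\<close>

lemma linear_basis_expansion:
  fixes f :: "'a::euclidean_space \<Rightarrow> real"
  assumes "linear f"
  shows "f x = (\<Sum>b\<in>Basis. (b \<bullet> x) * f b)"
proof -
  have "f x = f (\<Sum>b\<in>Basis. (x \<bullet> b) *\<^sub>R b)" by (simp add: euclidean_representation)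
  also have "\<dots> = (\<Sum>b\<in>Basis. (b \<bullet> x) * f b)"
    by (simp add: linear_sum[OF assms] linear_cmul[OF assms] inner_commute)
  finally show ?thesis .
qed

lemma linear_tensor2_apply: "linear (\<alpha> i)" "linear (\<lambda>i. \<alpha> i j)" "linear (\<lambda>\<beta> :: 'a tensor2. \<beta> i j)"
  for \<alpha> :: "('a::euclidean_space) tensor2"
  by (rule linearI; simp add: blinfun.bilinear_simps)+

lemma linear_tensor4_apply: "linear (X i j k)" "linear (\<lambda>i. X i j k l)"
  for X :: "('a::euclidean_space) tensor4"
  by (rule linearI; simp add: blinfun.bilinear_simps)+

lemma tensor2_basis_expansion:
  fixes \<alpha> :: "('a::euclidean_space) tensor2"
  shows "\<alpha> i j = (\<Sum>a\<in>Basis. \<Sum>b\<in>Basis. \<alpha> a b * ((a \<bullet> i) * (b \<bullet> j)))"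
proof -
  have "\<alpha> i j = (\<Sum>a\<in>Basis. (a \<bullet> i) * \<alpha> a j)"
    by (rule linear_basis_expansion) (rule linear_tensor2_apply)
  also have "\<dots> = (\<Sum>a\<in>Basis. (a \<bullet> i) * (\<Sum>b\<in>Basis. (b \<bullet> j) * \<alpha> a b))"
    by (intro sum.cong refl arg_cong2[where f = "(*)"] linear_basis_expansion linear_tensor2_apply)
  finally show ?thesis by (simp add: sum_distrib_left mult_ac)
qed

text \<open>Invariance of contraction under the orthogonal group: \<open>inv g\<close> is the
  adjoint of \<open>g\<close>, so it can be moved from one contracted slot to the other.\<close>

lemma orthogonal_change_of_basis:
  fixes f k :: "'a::euclidean_space \<Rightarrow> real"
  assumes g: "orthogonal_transformation g" and f: "linear f" and k: "linear k"
  shows "(\<Sum>p\<in>Basis. f (inv g p) * k p) = (\<Sum>p\<in>Basis. f p * k (g p))"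
proof -
  have adj: "q \<bullet> inv g p = g q \<bullet> p" for p q
    using g orthogonal_transformation_surj[OF g]
    by (metis orthogonal_transformation_def surj_f_inv_f)
  have "(\<Sum>p\<in>Basis. f (inv g p) * k p) = (\<Sum>p\<in>Basis. \<Sum>q\<in>Basis. (q \<bullet> inv g p) * f q * k p)"
    by (subst linear_basis_expansion[OF f]) (simp add: sum_distrib_right)
  also have "\<dots> = (\<Sum>q\<in>Basis. \<Sum>p\<in>Basis. f q * ((p \<bullet> g q) * k p))"
    by (subst sum.swap) (simp add: adj inner_commute mult_ac)
  also have "\<dots> = (\<Sum>q\<in>Basis. f q * k (g q))"
    by (subst (2) linear_basis_expansion[OF k]) (simp add: sum_distrib_left)
  finally show ?thesis .
qed

section \<open>Linearity, symmetry and equivariance of \<open>hat\<close>\<close>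

lemma tensor2_eqI:
  fixes \<alpha> \<beta> :: "('a::euclidean_space) tensor2"
  assumes "\<And>i j. \<alpha> i j = \<beta> i j"
  shows "\<alpha> = \<beta>"
  by (intro blinfun_eqI) (rule assms)

lemma hat_add: "hat X (\<alpha> + \<beta>) = hat X \<alpha> + hat X \<beta>"
  by (rule tensor2_eqI) (simp add: hat_apply blinfun.bilinear_simps distrib_left sum.distrib)

lemma hat_scaleR: "hat X (c *\<^sub>R \<alpha>) = c *\<^sub>R hat X \<alpha>"
  by (rule tensor2_eqI) (simp add: hat_apply blinfun.bilinear_simps sum_distrib_left mult_ac)

lemma hat_add_left: "hat (X + Y) \<alpha> = hat X \<alpha> + hat Y \<alpha>"
  by (rule tensor2_eqI) (simp add: hat_apply blinfun.bilinear_simps distrib_right sum.distrib)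

lemma hat_scaleR_left: "hat (c *\<^sub>R X) \<alpha> = c *\<^sub>R hat X \<alpha>"
  by (rule tensor2_eqI) (simp add: hat_apply blinfun.bilinear_simps sum_distrib_left mult_ac)

text \<open>Pair symmetry and \<open>MC_flip\<close> together exchange \<open>p\<close> with
  \<open>q\<close> and \<open>i\<close> with \<open>j\<close>. Hence \<open>hat X\<close> commutes
  with transposition, which is why it preserves \<open>Lambda2\<close> and
  \<open>Sym2\<close>.\<close>

lemma hat_transpose:
  fixes X :: "('a::euclidean_space) tensor4"
  assumes "X \<in> MC"
  shows "hat X \<alpha> j i = (\<Sum>p\<in>Basis. \<Sum>q\<in>Basis. X p i j q * \<alpha> q p)"
proof -
  have "X q j i p = X p i j q" for p q
    using MC_pair_symmetric[OF assms, of q j i p] MC_flip[OF assms, of i p q j] by simp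
  then show ?thesis
    unfolding hat_apply by (subst sum.swap) simp
qed

text \<open>The matrix of \<open>hat X\<close> in the index pairs \<open>(i, j)\<close> and
  \<open>(p, q)\<close> is symmetric, since \<open>X p i j q = X i p q j\<close>.\<close>

lemma inner2_hat:
  fixes X :: "('a::euclidean_space) tensor4"
  assumes "X \<in> MC"
  shows "inner2 (hat X \<alpha>) \<beta> = inner2 \<alpha> (hat X \<beta>)"
proof -
  let ?S = "\<lambda>f. \<Sum>i\<in>Basis. \<Sum>j\<in>Basis. \<Sum>p\<in>Basis. \<Sum>q\<in>Basis. f i j p q :: real"
  \<comment> \<open>Each pair is treated as a single index in \<open>Basis \<times> Basis\<close>,
    so that one \<open>sum.swap\<close> exchanges the pairs.\<close>
  have swap: "?S f = ?S (\<lambda>i j p q. f p q i j)" for f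
    using sum.swap[of "\<lambda>x y. f (fst x) (snd x) (fst y) (snd y)" "Basis \<times> Basis" "Basis \<times> Basis"]
    by (simp only: sum.cartesian_product' fst_conv snd_conv)
  have "inner2 (hat X \<alpha>) \<beta> = ?S (\<lambda>i j p q. X p i j q * \<alpha> p q * \<beta> i j)"
    by (simp add: inner2_def hat_apply sum_distrib_right)
  also have "\<dots> = ?S (\<lambda>i j p q. X i p q j * \<alpha> i j * \<beta> p q)"
    by (rule swap)
  also have "\<dots> = ?S (\<lambda>i j p q. \<alpha> i j * (X p i j q * \<beta> p q))"
    by (intro sum.cong refl, subst MC_flip[OF assms]) simp
  also have "\<dots> = inner2 \<alpha> (hat X \<beta>)"
    by (simp add: inner2_def hat_apply sum_distrib_left)
  finally show ?thesis .
qed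

lemma act4_MC:
  assumes "orthogonal_transformation g" "X \<in> MC"
  shows "act4 g X \<in> MC"
  by (rule MC_I; unfold act4_apply[OF assms(1)])
    (rule MC_antisym12[OF assms(2)] MC_antisym34[OF assms(2)] MC_bianchi[OF assms(2)])+

lemma act2_inv_apply:
  assumes "orthogonal_transformation g"
  shows "act2 (inv g) \<alpha> i j = \<alpha> (g i) (g j)"
  using act2_apply[OF orthogonal_transformation_inv[OF assms]]
  by (simp add: inv_inv_eq[OF orthogonal_transformation_bij[OF assms]])

text \<open>Change of basis in the two contracted slots moves \<open>inv g\<close> off
  \<open>X\<close> and puts \<open>g\<close> on \<open>\<alpha>\<close>; the free slots account for
  the outer \<open>act2 g\<close>.\<close>

lemma hat_act4:
  fixes X :: "('a::euclidean_space) tensor4"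
  assumes g: "orthogonal_transformation g"
  shows "hat (act4 g X) \<alpha> = act2 g (hat X (act2 (inv g) \<alpha>))"
proof (rule tensor2_eqI)
  fix i j
  let ?i = "inv g i" and ?j = "inv g j"
  have "hat (act4 g X) \<alpha> i j = (\<Sum>p\<in>Basis. \<Sum>q\<in>Basis. X (inv g p) ?i ?j (inv g q) * \<alpha> p q)"
    by (simp add: hat_apply act4_apply[OF g])
  also have "\<dots> = (\<Sum>p\<in>Basis. \<Sum>q\<in>Basis. X (inv g p) ?i ?j q * \<alpha> p (g q))"
    by (intro sum.cong refl orthogonal_change_of_basis[OF g] linear_tensor4_apply
        linear_tensor2_apply)
  also have "\<dots> = (\<Sum>q\<in>Basis. \<Sum>p\<in>Basis. X p ?i ?j q * \<alpha> (g p) (g q))"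
    by (subst sum.swap) (intro sum.cong refl orthogonal_change_of_basis[OF g]
        linear_tensor4_apply linear_tensor2_apply)
  also have "\<dots> = act2 g (hat X (act2 (inv g) \<alpha>)) i j"
    by (subst sum.swap) (simp add: act2_apply[OF g] hat_apply act2_inv_apply[OF g])
  finally show "hat (act4 g X) \<alpha> i j = act2 g (hat X (act2 (inv g) \<alpha>)) i j" .
qed

section \<open>Images of projections built from the transposition\<close>

text \<open>Transposition squares to the identity, so \<open>idem\<close> says exactly that
  \<open>c\<close> times the identity plus \<open>d\<close> times transposition is idempotent;
  \<open>W\<close> is given as its fixed space.\<close>

locale transpose_projection =
  fixes W :: "('a::euclidean_space) tensor2 set" and c d :: real
  assumes mem_iff: "\<alpha> \<in> W \<longleftrightarrow> (\<forall>i j. c * \<alpha> i j + d * \<alpha> j i = \<alpha> i j)"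
    and idem: "c * c + d * d = c" "2 * c * d = d"
begin

lemma mem_fixed: "c * \<alpha> i j + d * \<alpha> j i = \<alpha> i j" if "\<alpha> \<in> W" for \<alpha>
  using that mem_iff by blast

lemma subspace: "subspace W"
proof (rule subspaceI)
  show "0 \<in> W" by (simp add: mem_iff)
  show "x + y \<in> W" if "x \<in> W" "y \<in> W" for x y
    using mem_fixed[OF that(1)] mem_fixed[OF that(2)]
    by (simp add: mem_iff blinfun.bilinear_simps distrib_left) (smt (verit))
  show "r *\<^sub>R x \<in> W" if "x \<in> W" for r x
    unfolding mem_iff
  proof (intro allI)
    fix i j
    have "c * (r *\<^sub>R x) i j + d * (r *\<^sub>R x) j i = r * (c * x i j + d * x j i)"
      by (simp add: blinfun.bilinear_simps algebra_simps)
    then show "c * (r *\<^sub>R x) i j + d * (r *\<^sub>R x) j i = (r *\<^sub>R x) i j"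
      by (simp add: mem_fixed[OF that] blinfun.bilinear_simps)
  qed
qed

text \<open>By \<open>hat_transpose\<close>, \<open>hat X\<close> commutes with the projection, so
  it preserves the fixed space.\<close>

lemma hat_mem:
  assumes "X \<in> MC" "\<alpha> \<in> W"
  shows "hat X \<alpha> \<in> W"
  unfolding mem_iff
proof (intro allI)
  fix i j
  have "c * hat X \<alpha> i j + d * hat X \<alpha> j i
      = (\<Sum>p\<in>Basis. \<Sum>q\<in>Basis. X p i j q * (c * \<alpha> p q + d * \<alpha> q p))"
    unfolding hat_transpose[OF assms(1), where i = i and j = j] hat_apply[where i = i and j = j]
    by (simp add: sum_distrib_left sum.distrib[symmetric] algebra_simps)
  then show "c * hat X \<alpha> i j + d * hat X \<alpha> j i = hat X \<alpha> i j"
    by (simp add: mem_fixed[OF assms(2)] hat_apply)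
qed

text \<open>As \<open>g\<close> is surjective, testing on all \<open>g i\<close>, \<open>g j\<close>
  is testing on all vectors. This matches the case distinctions in \<open>hat_on\<close> on both
  sides of equivariance.\<close>

lemma act2_inv_mem_iff:
  assumes g: "orthogonal_transformation g"
  shows "act2 (inv g) \<alpha> \<in> W \<longleftrightarrow> \<alpha> \<in> W"
proof -
  have "(\<forall>i j. P (g i) (g j)) \<longleftrightarrow> (\<forall>i j. P i j)" for P
    using orthogonal_transformation_surj[OF g] by (metis surjD)
  from this[of "\<lambda>i j. c * \<alpha> i j + d * \<alpha> j i = \<alpha> i j"] show ?thesis
    by (simp only: mem_iff act2_inv_apply[OF g])
qed

section \<open>The projected basis tensors and the trace\<close>

text \<open>This is the projection of the tensor product of the covectors dual to \<open>a\<close>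
  and \<open>b\<close> under \<open>h\<close>.\<close>

definition frame :: "'a \<Rightarrow> 'a \<Rightarrow> 'a tensor2" where
  "frame a b = tensor2_of (\<lambda>i j. c * ((a \<bullet> i) * (b \<bullet> j)) + d * ((a \<bullet> j) * (b \<bullet> i)))"

lemma frame_apply: "frame a b i j = c * ((a \<bullet> i) * (b \<bullet> j)) + d * ((a \<bullet> j) * (b \<bullet> i))"
  unfolding frame_def
  by (rule tensor2_of_apply; rule linearI) (simp_all add: inner_simps algebra_simps)

lemma frame_mem: "frame a b \<in> W"
  unfolding mem_iff
proof (intro allI)
  fix i j
  define x y where "x = (a \<bullet> i) * (b \<bullet> j)" and "y = (a \<bullet> j) * (b \<bullet> i)"
  have "c * (c * x + d * y) + d * (c * y + d * x) = (c * c + d * d) * x + (2 * c * d) * y"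
    by (simp add: algebra_simps)
  then show "c * frame a b i j + d * frame a b j i = frame a b i j"
    unfolding frame_apply idem x_def y_def by simp
qed

text \<open>Apply the projection, which fixes \<open>\<alpha>\<close>, to the usual expansion in
  products of basis covectors. The entries \<open>\<alpha> a b\<close> thus serve as coefficient
  functionals even where the frame is redundant.\<close>

lemma frame_expansion:
  assumes "\<alpha> \<in> W"
  shows "\<alpha> = (\<Sum>a\<in>Basis. \<Sum>b\<in>Basis. \<alpha> a b *\<^sub>R frame a b)"
proof (rule tensor2_eqI)
  fix i j
  have "\<alpha> i j = c * \<alpha> i j + d * \<alpha> j i"
    by (rule mem_fixed[OF assms, symmetric])
  also have "\<dots> = (\<Sum>a\<in>Basis. \<Sum>b\<in>Basis. \<alpha> a b * frame a b i j)"
    unfolding frame_apply tensor2_basis_expansion[of \<alpha> i j] tensor2_basis_expansion[of \<alpha> j i]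
    by (simp add: sum_distrib_left sum.distrib distrib_left mult_ac)
  finally show "\<alpha> i j = (\<Sum>a\<in>Basis. \<Sum>b\<in>Basis. \<alpha> a b *\<^sub>R frame a b) i j"
    by (simp add: blinfun.sum_left blinfun.scaleR_left)
qed

lemma hat_frame:
  "hat Y (frame a b) i j = c * Y a i j b + d * Y b i j a"
proof -
  have "(\<Sum>p\<in>Basis. \<Sum>q\<in>Basis. Y p i j q * ((a \<bullet> p) * (b \<bullet> q))) = Y a i j b" for a b
  proof -
    have "Y a i j b = (\<Sum>p\<in>Basis. (p \<bullet> a) * Y p i j b)"
      by (rule linear_basis_expansion) (rule linear_tensor4_apply)
    also have "\<dots> = (\<Sum>p\<in>Basis. (p \<bullet> a) * (\<Sum>q\<in>Basis. (q \<bullet> b) * Y p i j q))"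
      by (intro sum.cong refl arg_cong2[where f = "(*)"] linear_basis_expansion
          linear_tensor4_apply)
    finally show ?thesis by (simp add: sum_distrib_left mult_ac inner_commute)
  qed
  note this[of a b] this[of b a]
  moreover have "hat Y (frame a b) i j
      = c * (\<Sum>p\<in>Basis. \<Sum>q\<in>Basis. Y p i j q * ((a \<bullet> p) * (b \<bullet> q)))
      + d * (\<Sum>p\<in>Basis. \<Sum>q\<in>Basis. Y p i j q * ((b \<bullet> p) * (a \<bullet> q)))"
    unfolding hat_apply frame_apply
    by (simp add: sum_distrib_left sum.distrib[symmetric] algebra_simps)
  ultimately show ?thesis by simp
qed

lemma trace_on_W:
  assumes "\<And>x. x \<in> W \<Longrightarrow> A x \<in> W"
    "\<And>x y. x \<in> W \<Longrightarrow> y \<in> W \<Longrightarrow> A (x + y) = A x + A y"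
    "\<And>r x. x \<in> W \<Longrightarrow> A (r *\<^sub>R x) = r *\<^sub>R A x"
  shows "trace_on W A = (\<Sum>a\<in>Basis. \<Sum>b\<in>Basis. A (frame a b) a b)"
proof -
  have "\<alpha> = (\<Sum>t\<in>Basis \<times> Basis. \<alpha> (fst t) (snd t) *\<^sub>R frame (fst t) (snd t))" if "\<alpha> \<in> W" for \<alpha>
    unfolding sum.cartesian_product' fst_conv snd_conv by (rule frame_expansion[OF that])
  then have "trace_on W A = (\<Sum>t\<in>Basis \<times> Basis. A (frame (fst t) (snd t)) (fst t) (snd t))"
    by (intro trace_on_frame[where \<phi> = "\<lambda>t (\<alpha> :: 'a tensor2). \<alpha> (fst t) (snd t)"] subspace
        frame_mem assms linear_tensor2_apply finite_cartesian_product finite_Basis)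
  then show ?thesis by (simp only: sum.cartesian_product' fst_conv snd_conv)
qed

text \<open>The factors \<open>r\<close> and \<open>s\<close> let one computation serve both the
  trace identities and the rescaled maps.\<close>

lemma trace_scaled_hat:
  assumes X: "X \<in> MC" and Y: "Y \<in> MC"
  shows "trace_on W ((\<lambda>\<alpha>. r *\<^sub>R hat_on W X \<alpha>) \<circ> (\<lambda>\<alpha>. s *\<^sub>R hat_on W Y \<alpha>))
    = r * s * (c + d / 2) * inner4 X Y"
proof -
  have hat_on: "hat_on W Z \<alpha> = hat Z \<alpha>" if "\<alpha> \<in> W" for Z \<alpha>
    using that by (simp add: hat_on_def)
  let ?A = "(\<lambda>\<alpha>. r *\<^sub>R hat_on W X \<alpha>) \<circ> (\<lambda>\<alpha>. s *\<^sub>R hat_on W Y \<alpha>)"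
  have A: "?A \<alpha> = (r * s) *\<^sub>R hat X (hat Y \<alpha>)" if "\<alpha> \<in> W" for \<alpha>
    using that by (simp add: hat_on hat_mem[OF Y] subspace_scale[OF subspace] hat_scaleR)
  have "trace_on W ?A = (\<Sum>a\<in>Basis. \<Sum>b\<in>Basis. ?A (frame a b) a b)"
    by (rule trace_on_W)
      (simp_all only: A hat_mem[OF Y] hat_mem[OF X] subspace_add[OF subspace]
        subspace_scale[OF subspace] hat_add hat_scaleR scaleR_add_right scaleR_left_commute)
  also have "\<dots> = r * s * (\<Sum>a\<in>Basis. \<Sum>b\<in>Basis. hat X (hat Y (frame a b)) a b)"
    by (simp add: A frame_mem blinfun.scaleR_left sum_distrib_left del: o_apply)
  also have "(\<Sum>a\<in>Basis. \<Sum>b\<in>Basis. hat X (hat Y (frame a b)) a b)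
      = (\<Sum>a\<in>Basis. \<Sum>b\<in>Basis. \<Sum>p\<in>Basis. \<Sum>q\<in>Basis.
          X p a b q * (c * Y p a b q + d * Y p b a q))"
    unfolding hat_apply[of X] hat_frame
    \<comment> \<open>Flipping \<open>Y\<close> puts \<open>p\<close> first and \<open>q\<close>
      last, as in \<open>X p a b q\<close>; the transposed part of the frame then differs only by
      exchanging the middle slots.\<close>
    by (intro sum.cong refl, subst (1 2) MC_flip[OF Y]) simp
  also have "\<dots> = (\<Sum>a\<in>Basis. \<Sum>p\<in>Basis. \<Sum>b\<in>Basis. \<Sum>q\<in>Basis.
          X p a b q * (c * Y p a b q + d * Y p b a q))"
    by (intro sum.cong refl sum.swap)
  also have "\<dots> = (\<Sum>p\<in>Basis. \<Sum>a\<in>Basis. \<Sum>b\<in>Basis. \<Sum>q\<in>Basis.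
          X p a b q * (c * Y p a b q + d * Y p b a q))"
    by (rule sum.swap)
  \<comment> \<open>The remaining sum is the contraction evaluated by
    \<open>inner4_transpose23\<close>, whence the coefficient \<open>d / 2\<close>.\<close>
  also have "\<dots> = c * inner4 X Y
      + d * (\<Sum>p\<in>Basis. \<Sum>a\<in>Basis. \<Sum>b\<in>Basis. \<Sum>q\<in>Basis. X p a b q * Y p b a q)"
    by (simp add: inner4_def sum_distrib_left sum.distrib distrib_left mult_ac)
  finally show ?thesis
    by (simp add: inner4_transpose23[OF X Y] algebra_simps del: o_apply)
qed

lemma trace_hat:
  assumes "X \<in> MC" "Y \<in> MC"
  shows "trace_on W (hat_on W X \<circ> hat_on W Y) = (c + d / 2) * inner4 X Y"
  using trace_scaled_hat[OF assms, of 1 1] by simp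

section \<open>The rescaled maps as isometric equivariant embeddings\<close>

text \<open>The trace of the square of the rescaled map is \<open>s * s * (c + d / 2)\<close> times
  \<open>inner4 X X\<close>, so the assumption is the normalization that makes it isometric.\<close>

lemma isometric_O_embedding_hat:
  assumes s: "s * s * (c + d / 2) = 1"
  shows "isometric_O_embedding W (\<lambda>X \<alpha>. s *\<^sub>R hat_on W X \<alpha>)"
    (is "isometric_O_embedding W ?\<Phi>")
proof -
  have Sym: "?\<Phi> X \<in> Sym_on W" if "X \<in> MC" for X
  proof -
    have "inner2 (r *\<^sub>R \<alpha>) \<beta> = r * inner2 \<alpha> \<beta>" "inner2 \<alpha> (r *\<^sub>R \<beta>) = r * inner2 \<alpha> \<beta>"
      for r and \<alpha> \<beta> :: "'a tensor2"
      by (simp_all add: inner2_def blinfun.scaleR_left sum_distrib_left mult_ac)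
    then show ?thesis
      using that subspace
      by (simp add: Sym_on_def End_on_def hat_on_def hat_mem subspace_scale subspace_add
          hat_add hat_scaleR scaleR_add_right inner2_hat mult.commute)
  qed
  have lin: "linear_to_Sym_on W ?\<Phi>"
    using Sym
    by (auto simp: linear_to_Sym_on_def hat_on_def hat_add_left hat_scaleR_left
        scaleR_add_right)
  have "?\<Phi> (act4 g X) = act_End g (?\<Phi> X)"
    if g: "orthogonal_transformation g" for g X
  proof
    fix \<alpha>
    \<comment> \<open>The zero case covers tensors outside \<open>W\<close>, where
      \<open>hat_on\<close> vanishes.\<close>
    have "act2 g (s *\<^sub>R \<beta>) = s *\<^sub>R act2 g \<beta>" "act2 g 0 = 0" for \<beta>
      by (rule tensor2_eqI; simp add: act2_apply[OF g] blinfun.scaleR_left)+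
    then show "?\<Phi> (act4 g X) \<alpha> = act_End g (?\<Phi> X) \<alpha>"
      by (simp add: act_End_def hat_on_def act2_inv_mem_iff[OF g] hat_act4[OF g])
  qed
  then have equi: "O_equivariant ?\<Phi>"
    using act4_MC unfolding O_equivariant_def by blast
  have iso: "trace_isometric W ?\<Phi>"
    using trace_scaled_hat[of _ _ s s] s
    by (simp add: trace_isometric_def trace_norm_def norm4_def)
  have "inj_on ?\<Phi> MC"
  proof (rule inj_onI)
    fix X Y :: "'a tensor4"
    assume X: "X \<in> MC" and Y: "Y \<in> MC" and eq: "?\<Phi> X = ?\<Phi> Y"
    have Z: "X - Y \<in> MC" using X Y subspace_MC by (rule subspace_diff[rotated])
    have "hat_on W X \<alpha> = hat_on W (X - Y) \<alpha> + hat_on W Y \<alpha>" for \<alpha>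
      using hat_add_left[of "X - Y" Y \<alpha>] by (simp add: hat_on_def)
    then have "?\<Phi> (X - Y) \<alpha> = ?\<Phi> X \<alpha> - ?\<Phi> Y \<alpha>" for \<alpha>
      by (simp add: scaleR_add_right)
    \<comment> \<open>The zero endomorphism has trace-norm zero, so isometry forces
      \<open>norm4 (X - Y) = 0\<close> and definiteness applies.\<close>
    then have "?\<Phi> (X - Y) = (\<lambda>\<alpha>. 0)"
      using fun_cong[OF eq] by (auto simp: fun_eq_iff)
    moreover have "trace_norm W (\<lambda>\<alpha>. 0) = 0"
      unfolding trace_norm_def by (subst trace_on_W) (simp_all add: subspace_0[OF subspace])
    moreover have "trace_norm W (?\<Phi> (X - Y)) = norm4 (X - Y)"
      using iso Z unfolding trace_isometric_def by blast
    ultimately have "norm4 (X - Y) = 0" by simp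
    then show "X = Y"
      using inner4_eq_0D[of "X - Y"] by (simp add: norm4_def)
  qed
  with lin equi iso show ?thesis by (simp add: isometric_O_embedding_def)
qed

end

section \<open>The three spaces and their normalizing constants\<close>

theorem corollary4p5:
  shows
    "(\<forall>X\<in>(MC :: ('a::euclidean_space) tensor4 set). \<forall>Y\<in>MC.
        trace_on Lambda2 (hat_on Lambda2 X \<circ> hat_on Lambda2 Y) = 1/4 * inner4 X Y) \<and>
     (\<forall>X\<in>(MC :: 'a tensor4 set). \<forall>Y\<in>MC.
        trace_on Sym2 (hat_on Sym2 X \<circ> hat_on Sym2 Y) = 3/4 * inner4 X Y) \<and>
     isometric_O_embedding Lambda2 (\<lambda>(X :: 'a tensor4) \<alpha>. 2 *\<^sub>R hat_on Lambda2 X \<alpha>) \<and>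
     isometric_O_embedding Sym2 (\<lambda>(X :: 'a tensor4) \<alpha>. (2 / sqrt 3) *\<^sub>R hat_on Sym2 X \<alpha>) \<and>
     isometric_O_embedding UNIV (\<lambda>(X :: 'a tensor4). hat_on UNIV X)"
proof -
  \<comment> \<open>These turn the fixed-point equations of the projections into antisymmetry and
    symmetry.\<close>
  have half: "1/2 * a + -1/2 * b = a \<longleftrightarrow> b = - a" "1/2 * a + 1/2 * b = a \<longleftrightarrow> b = a"
    for a b :: real
    by auto
  interpret \<Lambda>: transpose_projection "Lambda2 :: 'a tensor2 set" "1/2" "-1/2"
    by unfold_locales (unfold half Lambda2_def, simp_all)
  interpret S: transpose_projection "Sym2 :: 'a tensor2 set" "1/2" "1/2"
    by unfold_locales (unfold half Sym2_def, simp_all)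
  interpret U: transpose_projection "UNIV :: 'a tensor2 set" 1 0
    by unfold_locales simp_all
  \<comment> \<open>The values of \<open>c + d / 2\<close> are 1/4, 3/4 and 1; the squares of 2,
    \<open>2 / sqrt 3\<close> and 1 are their reciprocals.\<close>
  show ?thesis
    using \<Lambda>.trace_hat S.trace_hat \<Lambda>.isometric_O_embedding_hat[of 2]
      S.isometric_O_embedding_hat[of "2 / sqrt 3"] U.isometric_O_embedding_hat[of 1]
    by simp
qed

end
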